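(* Let $n$ be a positive integer and $x,y,z\in\mathbb{R}$, and let $C_n$ denote the connected 2-regular graph with $n$ vertices (so $C_1$ is a single vertex with a loop and $C_2$ consists of two vertices joined by two parallel edges). Put $D := x^2+2xy+y^2+4z$ and \[ \varphi = \begin{cases} \arctan \frac{\sqrt{-D}}{x+y} & \text{if } x+y > 0, \\ \pi/2 & \text{if } x+y=0, \\ \pi+\arctan \frac{\sqrt{-D}}{x+y} & \text{if } x+y < 0. \end{cases} \] If $z \ge -\left(\frac{x+y}{2}\right)^2$, then \[ \xi(C_n;x,y,z) = \left(\frac{x + y - \sqrt{D}}{2}\right)^{n} + \left(\frac{x + y + \sqrt{D}}{2}\right)^{n} + y^{n-1}(xy-y+z). \] If $z \le -\left(\frac{x+y}{2}\right)^2$, then \[ \xi(C_n;x,y,z) = 2(-z)^{n/2} \cos(n\varphi) + y^{n-1} (xy-y+z). \]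
   Context: All graphs are finite and undirected and may have loops and multiple edges. For a graph $G$ and an edge $e$: $G_{-e}$ is the graph obtained by removing $e$; $G_{/e}$ is the graph obtained by removing $e$ and identifying its endpoints; $G_{\dagger e}$ is the graph obtained by removing $e$ and all vertices incident with $e$. $P_n$ denotes the simple path with $n$ vertices ($n=0,1,\dots$; $P_0$ is the empty graph) and $\oplus$ denotes disjoint union. The universal edge elimination polynomial $\xi(G;x,y,z)$ is defined by $\xi(P_0;x,y,z)=1$, $\xi(P_1;x,y,z)=x$, $\xi(G;x,y,z) = \xi(G_{-e};x,y,z) + y\,\xi(G_{/e};x,y,z) + z\,\xi(G_{\dagger e};x,y,z)$ for every edge $e$ of $G$, and $\xi(G_1\oplus G_2;x,y,z)=\xi(G_1;x,y,z)\,\xi(G_2;x,y,z)$. *)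

theory Defs
  imports Complex_Main "HOL-Library.FuncSet"
begin

text \<open>An edge has one end (a loop) or two ends. Distinct edges may have the same ends.\<close>

record ('v, 'e) multigraph =
  verts :: "'v set"
  edges :: "'e set"
  ends :: "'e \<Rightarrow> 'v set"

definition multigraph :: "('v, 'e) multigraph \<Rightarrow> bool" where
  "multigraph G \<longleftrightarrow> finite (verts G) \<and> finite (edges G) \<and>
     (\<forall>e\<in>edges G. ends G e \<subseteq> verts G \<and> card (ends G e) \<in> {1, 2})"

definition delete_edge :: "('v, 'e) multigraph \<Rightarrow> 'e \<Rightarrow> ('v, 'e) multigraph" where
  "delete_edge G e = G\<lparr>edges := edges G - {e}\<rparr>"

text \<open>The parameter \<open>u\<close> is the end of \<open>e\<close> that serves as the name of the merged vertex.\<close>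

definition contract_edge :: "('v, 'e) multigraph \<Rightarrow> 'e \<Rightarrow> 'v \<Rightarrow> ('v, 'e) multigraph" where
  "contract_edge G e u =
     (let h = (\<lambda>w. if w \<in> ends G e then u else w)
      in \<lparr>verts = h ` verts G, edges = edges G - {e}, ends = (\<lambda>d. h ` ends G d)\<rparr>)"

definition extract_edge :: "('v, 'e) multigraph \<Rightarrow> 'e \<Rightarrow> ('v, 'e) multigraph" where
  "extract_edge G e =
     \<lparr>verts = verts G - ends G e,
      edges = {d \<in> edges G. ends G d \<inter> ends G e = {}},
      ends = ends G\<rparr>"

definition disjoint_graphs :: "('v, 'e) multigraph \<Rightarrow> ('v, 'e) multigraph \<Rightarrow> bool" where
  "disjoint_graphs G H \<longleftrightarrow> verts G \<inter> verts H = {} \<and> edges G \<inter> edges H = {}"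

definition graph_union ::
    "('v, 'e) multigraph \<Rightarrow> ('v, 'e) multigraph \<Rightarrow> ('v, 'e) multigraph" where
  "graph_union G H =
     \<lparr>verts = verts G \<union> verts H, edges = edges G \<union> edges H,
      ends = (\<lambda>e. if e \<in> edges G then ends G e else ends H e)\<rparr>"

text \<open>
  The four defining equations of the universal edge elimination polynomial, where \<open>f G x y z\<close>
  stands for its value at \<open>(x, y, z)\<close>. Contraction is required to satisfy the
  edge equation for either name of the merged vertex, and every graph with one vertex and no edge
  counts as \<open>P\<^sub>1\<close>. Invariance under isomorphism is not assumed: it follows from the equations.
\<close>

definition edge_elimination ::
    "(('v, 'e) multigraph \<Rightarrow> real \<Rightarrow> real \<Rightarrow> real \<Rightarrow> real) \<Rightarrow> bool" where
  "edge_elimination f \<longleftrightarrow> (\<forall>x y z.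
     (\<forall>G. multigraph G \<and> verts G = {} \<longrightarrow> f G x y z = 1) \<and>
     (\<forall>G v. multigraph G \<and> verts G = {v} \<and> edges G = {} \<longrightarrow> f G x y z = x) \<and>
     (\<forall>G e u. multigraph G \<and> e \<in> edges G \<and> u \<in> ends G e \<longrightarrow>
        f G x y z = f (delete_edge G e) x y z + y * f (contract_edge G e u) x y z
                      + z * f (extract_edge G e) x y z) \<and>
     (\<forall>G H. multigraph G \<and> multigraph H \<and> disjoint_graphs G H \<longrightarrow>
        f (graph_union G H) x y z = f G x y z * f H x y z))"

text \<open>
  Records violating \<^const>\<open>multigraph\<close> are not constrained by the equations; restricting to
  \<^const>\<open>extensional\<close> functions is only there to make the description determine a function.
\<close>

definition xi :: "('v, 'e) multigraph \<Rightarrow> real \<Rightarrow> real \<Rightarrow> real \<Rightarrow> real" where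
  "xi = (THE f. edge_elimination f \<and> f \<in> extensional {G. multigraph G})"

text \<open>A loop contributes 2 to the degree of its vertex.\<close>

definition degree :: "('v, 'e) multigraph \<Rightarrow> 'v \<Rightarrow> nat" where
  "degree G v = card {e \<in> edges G. v \<in> ends G e} + card {e \<in> edges G. ends G e = {v}}"

definition regular :: "nat \<Rightarrow> ('v, 'e) multigraph \<Rightarrow> bool" where
  "regular k G \<longleftrightarrow> (\<forall>v\<in>verts G. degree G v = k)"

definition adjacency :: "('v, 'e) multigraph \<Rightarrow> ('v \<times> 'v) set" where
  "adjacency G = {(u, v). \<exists>e\<in>edges G. ends G e = {u, v}}"

definition connected_graph :: "('v, 'e) multigraph \<Rightarrow> bool" where
  "connected_graph G \<longleftrightarrow> verts G \<noteq> {} \<and>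
     (\<forall>u\<in>verts G. \<forall>v\<in>verts G. (u, v) \<in> (adjacency G)\<^sup>*)"

definition is_cycle :: "nat \<Rightarrow> ('v, 'e) multigraph \<Rightarrow> bool" where
  "is_cycle n G \<longleftrightarrow> multigraph G \<and> connected_graph G \<and> regular 2 G \<and> card (verts G) = n"

end

theory Submission imports Defs begin

text \<open>
  The equations defining \<open>\<xi>\<close> are consistent because they are solved by the state sum
  \<open>\<Sum>F\<subseteq>E. \<Prod>K. w K\<close>, where \<open>K\<close> ranges over the components of the spanning subgraph \<open>(V, F)\<close>, an
  isolated vertex has weight \<open>x\<close>, and a component with \<open>m \<ge> 1\<close> edges has weight
  \<open>x * y ^ m + z * y ^ (m - 1)\<close>. Contracting an edge of \<open>F\<close> divides the weight of its component
  by \<open>y\<close>, unless it is the only edge there; the defect \<open>z\<close> is the extraction term.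

  A connected 2-regular graph is a maximal simple path closed up by one more edge. Eliminating the
  closing edge expresses \<open>\<xi>(C\<^sub>n)\<close> by \<open>\<xi>(P\<^sub>n)\<close>, \<open>\<xi>(C\<^sub>n\<^sub>-\<^sub>1)\<close> and \<open>\<xi>(P\<^sub>n\<^sub>-\<^sub>2)\<close>, and \<open>\<xi>(P\<^sub>n)\<close> satisfies
  the linear recurrence with characteristic polynomial \<open>t\<^sup>2 - (x + y) * t - z\<close>. Up to the term
  \<open>y ^ (n - 1) * (x * y - y + z)\<close>, \<open>\<xi>(C\<^sub>n)\<close> is then the sum of the \<open>n\<close>-th powers of the two roots.
\<close>

subsection \<open>The state sum\<close>

definition joined :: "('e \<Rightarrow> 'v set) \<Rightarrow> 'e set \<Rightarrow> ('v \<times> 'v) set" where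
  "joined E F = {(a, b). \<exists>d\<in>F. E d = {a, b}}\<^sup>*"

text \<open>The relation lives on the whole vertex type, so a vertex on no edge of \<open>F\<close>
  is a class by itself. When the edges of \<open>F\<close> lie in \<open>V\<close>,
  \<open>V // joined E F\<close> is therefore the set of components of the graph
  \<open>(V, F)\<close>, isolated vertices included.\<close>

lemma equiv_joined: "equiv UNIV (joined E F)"
proof (rule equivI)
  show "refl (joined E F)" unfolding joined_def by (rule refl_rtrancl)
  show "trans (joined E F)" unfolding joined_def by (rule trans_rtrancl)
  show "sym (joined E F)" unfolding joined_def
    by (rule sym_rtrancl) (auto simp: sym_def insert_commute)
qed simp

lemma joined_refl: "(a, a) \<in> joined E F"
  unfolding joined_def by simp

lemma joined_trans: "(a, b) \<in> joined E F \<Longrightarrow> (b, c) \<in> joined E F \<Longrightarrow> (a, c) \<in> joined E F"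
  unfolding joined_def by (rule rtrancl_trans)

lemma card_1_or_2_pair:
  assumes "card S \<in> {1, 2}" "a \<in> S" "b \<in> S" "a \<noteq> b"
  shows "S = {a, b}"
proof -
  have "finite S" using assms(1) by (auto intro: card_ge_0_finite)
  then show ?thesis
    using assms card_seteq[of S "{a, b}"] by auto
qed

lemma joined_ends:
  assumes "d \<in> F" "card (E d) \<in> {1, 2}" "a \<in> E d" "b \<in> E d"
  shows "(a, b) \<in> joined E F"
proof (cases "a = b")
  case False
  then have "E d = {a, b}" using card_1_or_2_pair assms by metis
  then show ?thesis unfolding joined_def using assms(1) by blast
qed (simp add: joined_refl)

lemma joined_cong: "(\<And>d. d \<in> F \<Longrightarrow> E d = E' d) \<Longrightarrow> joined E F = joined E' F"
  unfolding joined_def by (rule arg_cong[where f = rtrancl]) auto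

text \<open>No edge of \<open>F\<close> leaves \<open>S\<close>, so a walk starting in
  \<open>S\<close> stays there and uses only edges inside \<open>S\<close>.\<close>

lemma joined_local:
  assumes "\<And>d. d \<in> F \<Longrightarrow> E d \<subseteq> S \<or> E d \<inter> S = {}" "a \<in> S"
  shows "joined E F `` {a} = joined E {d\<in>F. E d \<subseteq> S} `` {a}"
    and "joined E F `` {a} \<subseteq> S"
proof -
  have 1: "b \<in> S \<and> (a, b) \<in> joined E {d\<in>F. E d \<subseteq> S}" if "(a, b) \<in> joined E F" for b
    using that unfolding joined_def
  proof (induction rule: rtrancl_induct)
    case base
    then show ?case using assms(2) by simp
  next
    case (step b c)
    then obtain d where d: "d \<in> F" "E d = {b, c}" by auto
    then have "E d \<subseteq> S" using assms(1)[of d] step.IH by auto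
    then have "(b, c) \<in> {(a, b). \<exists>d\<in>{d\<in>F. E d \<subseteq> S}. E d = {a, b}}" and "c \<in> S"
      using d by auto
    then show ?case using step.IH by (meson rtrancl.rtrancl_into_rtrancl)
  qed
  have "joined E {d\<in>F. E d \<subseteq> S} \<subseteq> joined E F"
    unfolding joined_def by (rule rtrancl_mono) auto
  then show "joined E F `` {a} = joined E {d\<in>F. E d \<subseteq> S} `` {a}" using 1 by auto
  show "joined E F `` {a} \<subseteq> S" using 1 by auto
qed

section \<open>Component weights under splitting, contraction and extraction\<close>

definition weight :: "real \<Rightarrow> real \<Rightarrow> real \<Rightarrow> nat \<Rightarrow> real" where
  "weight x y z m = (case m of 0 \<Rightarrow> x | Suc k \<Rightarrow> x * y ^ Suc k + z * y ^ k)"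

text \<open>The weights are geometric only from one edge on. The step from no edge to one breaks the
  pattern by \<open>z\<close>, which is why contraction splits into the two cases
  \<open>comp_prod_contract\<close> and \<open>comp_prod_extract\<close>.\<close>

lemma weight_Suc_Suc: "weight x y z (Suc (Suc m)) = y * weight x y z (Suc m)"
  by (simp add: weight_def algebra_simps)

definition comp_prod :: "real \<Rightarrow> real \<Rightarrow> real \<Rightarrow> 'v set \<Rightarrow> ('e \<Rightarrow> 'v set) \<Rightarrow> 'e set \<Rightarrow> real" where
  "comp_prod x y z V E F = (\<Prod>K\<in>V // joined E F. weight x y z (card {d\<in>F. E d \<subseteq> K}))"

lemma comp_prod_cong:
  assumes "\<And>d. d \<in> F \<Longrightarrow> E d = E' d"
  shows "comp_prod x y z V E F = comp_prod x y z V E' F"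
proof -
  have "{d\<in>F. E d \<subseteq> K} = {d\<in>F. E' d \<subseteq> K}" for K using assms by auto
  then show ?thesis unfolding comp_prod_def using joined_cong[of F E E'] assms by simp
qed

lemma comp_prod_empty: "comp_prod x y z {} E F = 1"
  by (simp add: comp_prod_def quotient_def)

lemma comp_prod_connected:
  assumes "V \<noteq> {}" "\<And>a b. a \<in> V \<Longrightarrow> b \<in> V \<Longrightarrow> (a, b) \<in> joined E F" "\<And>d. d \<in> F \<Longrightarrow> E d \<subseteq> V"
  shows "comp_prod x y z V E F = weight x y z (card F)"
proof -
  have "joined E F `` {a} = V" if "a \<in> V" for a
    using joined_local(2)[of F E V a] that assms by auto
  then have "V // joined E F = {V}"
    unfolding quotient_def using assms(1) by auto
  moreover have "{d\<in>F. E d \<subseteq> V} = F" using assms(3) by auto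
  ultimately show ?thesis unfolding comp_prod_def by simp
qed

text \<open>Every class lies on one side and is computed there by \<open>joined_local\<close>.
  Nonempty ends matter for the edge counts: an edge without ends would satisfy
  \<open>E d \<subseteq> K\<close> for every class on both sides.\<close>

lemma comp_prod_Un:
  assumes fin: "finite V1" "finite V2" and disj: "V1 \<inter> V2 = {}"
    and F1: "\<And>d. d \<in> F1 \<Longrightarrow> E d \<subseteq> V1 \<and> E d \<noteq> {}"
    and F2: "\<And>d. d \<in> F2 \<Longrightarrow> E d \<subseteq> V2 \<and> E d \<noteq> {}"
  shows "comp_prod x y z (V1 \<union> V2) E (F1 \<union> F2) = comp_prod x y z V1 E F1 * comp_prod x y z V2 E F2"
proof -
  let ?R = "joined E (F1 \<union> F2)"
  let ?w = "\<lambda>F K. weight x y z (card {d\<in>F. E d \<subseteq> K})"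
  \<comment> \<open>Stated for an arbitrary side \<open>V\<close> that no edge leaves, so that it
    serves both \<open>V1\<close> and \<open>V2\<close>.\<close>
  have side: "V // ?R = V // joined E F \<and> (\<forall>K\<in>V // ?R. K \<subseteq> V \<and> K \<noteq> {}) \<and>
      (\<Prod>K\<in>V // ?R. ?w (F1 \<union> F2) K) = comp_prod x y z V E F"
    if "\<And>d. d \<in> F1 \<union> F2 \<Longrightarrow> E d \<subseteq> V \<or> E d \<inter> V = {}" "F = {d\<in>F1 \<union> F2. E d \<subseteq> V}" for V F
  proof -
    have eq: "?R `` {a} = joined E F `` {a}" "?R `` {a} \<subseteq> V" if "a \<in> V" for a
      using joined_local[of "F1 \<union> F2" E V a] that \<open>\<And>d. d \<in> F1 \<union> F2 \<Longrightarrow> _\<close> \<open>F = _\<close> by auto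
    have q: "V // ?R = V // joined E F" unfolding quotient_def using eq by auto
    have sub: "\<forall>K\<in>V // ?R. K \<subseteq> V \<and> K \<noteq> {}"
      using eq joined_refl[of _ E "F1 \<union> F2"] unfolding quotient_def by blast
    have "{d\<in>F1 \<union> F2. E d \<subseteq> K} = {d\<in>F. E d \<subseteq> K}" if "K \<in> V // ?R" for K
      using sub that \<open>F = _\<close> by auto
    then show ?thesis using q sub unfolding comp_prod_def by auto
  qed
  have s1: "V1 // ?R = V1 // joined E F1 \<and> (\<forall>K\<in>V1 // ?R. K \<subseteq> V1 \<and> K \<noteq> {}) \<and>
      (\<Prod>K\<in>V1 // ?R. ?w (F1 \<union> F2) K) = comp_prod x y z V1 E F1"
    by (rule side) (use F1 F2 disj in \<open>blast+\<close>)
  have s2: "V2 // ?R = V2 // joined E F2 \<and> (\<forall>K\<in>V2 // ?R. K \<subseteq> V2 \<and> K \<noteq> {}) \<and>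
      (\<Prod>K\<in>V2 // ?R. ?w (F1 \<union> F2) K) = comp_prod x y z V2 E F2"
    by (rule side) (use F1 F2 disj in \<open>blast+\<close>)
  have "(V1 // ?R) \<inter> (V2 // ?R) = {}"
  proof (rule equals0I)
    fix K assume "K \<in> (V1 // ?R) \<inter> (V2 // ?R)"
    then have "K \<subseteq> V1 \<inter> V2" "K \<noteq> {}" using s1 s2 by simp_all
    then show False using disj by simp
  qed
  moreover have "finite (V1 // ?R)" "finite (V2 // ?R)"
    using fin unfolding quotient_def by auto
  moreover have "(V1 \<union> V2) // ?R = V1 // ?R \<union> V2 // ?R"
    unfolding quotient_def by (rule UN_Un)
  ultimately have "comp_prod x y z (V1 \<union> V2) E (F1 \<union> F2) =
      (\<Prod>K\<in>V1 // ?R. ?w (F1 \<union> F2) K) * (\<Prod>K\<in>V2 // ?R. ?w (F1 \<union> F2) K)"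
    unfolding comp_prod_def by (simp only: prod.union_disjoint)
  then show ?thesis
    by (simp only: s1[THEN conjunct2, THEN conjunct2] s2[THEN conjunct2, THEN conjunct2])
qed

text \<open>This is the vertex map local to \<open>contract_edge\<close>, named so that it can be
  used apart from graph records.\<close>

definition merge :: "'v set \<Rightarrow> 'v \<Rightarrow> 'v \<Rightarrow> 'v" where
  "merge A u w = (if w \<in> A then u else w)"

text \<open>A walk projects along \<open>h\<close>, steps along \<open>e\<close> becoming
  stationary. Conversely a projected walk lifts edge by edge, since two vertices with the same image
  are equal or both ends of \<open>e\<close>, and \<open>e\<close> itself joins them.\<close>

lemma joined_merge_iff:
  assumes e: "e \<in> F" "u \<in> E e" and card: "\<And>d. d \<in> F \<Longrightarrow> card (E d) \<in> {1, 2}"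
  defines "h \<equiv> merge (E e) u"
  shows "(h a, h b) \<in> joined (\<lambda>d. h ` E d) (F - {e}) \<longleftrightarrow> (a, b) \<in> joined E F"
proof
  assume "(a, b) \<in> joined E F"
  then show "(h a, h b) \<in> joined (\<lambda>d. h ` E d) (F - {e})"
    unfolding joined_def[of E F]
  proof (induction rule: rtrancl_induct)
    case base
    then show ?case by (rule joined_refl)
  next
    case (step b c)
    then obtain d where d: "d \<in> F" "E d = {b, c}" by auto
    have "(h b, h c) \<in> joined (\<lambda>d. h ` E d) (F - {e})"
    proof (cases "d = e")
      case True
      then have "h b = h c" using d unfolding h_def merge_def by auto
      then show ?thesis by (simp add: joined_refl)
    next
      case False
      then show ?thesis using d unfolding joined_def by (intro r_into_rtrancl) auto
    qed
    then show ?case using step.IH joined_trans by metis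
  qed
next
  have fibre: "(p, q) \<in> joined E F" if "h p = h q" for p q
  proof (cases "p = q")
    case False
    then have "p \<in> E e" "q \<in> E e"
      using that e(2) unfolding h_def merge_def by (auto split: if_splits)
    then show ?thesis using joined_ends e card by metis
  qed (simp add: joined_refl)
  \<comment> \<open>The walk runs through merged vertices, each possibly with several preimages, so
    the induction has to speak about all of them.\<close>
  have "\<forall>b. c = h b \<longrightarrow> (a, b) \<in> joined E F"
    if "(h a, c) \<in> joined (\<lambda>d. h ` E d) (F - {e})" for c
    using that unfolding joined_def[of "\<lambda>d. h ` E d"]
  proof (induction rule: rtrancl_induct)
    case base
    then show ?case using fibre by auto
  next
    case (step c c')
    then obtain d where d: "d \<in> F" "h ` E d = {c, c'}" by auto
    then obtain p q where pq: "p \<in> E d" "q \<in> E d" "h p = c" "h q = c'"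
      by (metis image_iff insertI1 insertI2)
    have "(a, p) \<in> joined E F" using step.IH pq by auto
    moreover have "(p, q) \<in> joined E F" using joined_ends d card pq by metis
    ultimately show ?case using fibre pq joined_trans by metis
  qed
  then show "(h a, h b) \<in> joined (\<lambda>d. h ` E d) (F - {e}) \<Longrightarrow> (a, b) \<in> joined E F" by simp
qed

text \<open>Taking images under \<open>h\<close> matches the components before and after
  contraction. Only the component \<open>K0\<close> of \<open>e\<close> loses an edge; since
  \<open>d\<close> remains in it, its edge count stays positive and its weight is divided by
  \<open>y\<close> in the sense of \<open>weight_Suc_Suc\<close>.\<close>

lemma comp_prod_contract:
  assumes fin: "finite V" "finite F"
    and F: "\<And>d. d \<in> F \<Longrightarrow> E d \<subseteq> V \<and> card (E d) \<in> {1, 2}"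
    and e: "e \<in> F" "u \<in> E e" and d: "d \<in> F" "d \<noteq> e" "E d \<inter> E e \<noteq> {}"
  defines "h \<equiv> merge (E e) u"
  shows "comp_prod x y z V E F = y * comp_prod x y z (h ` V) (\<lambda>d. h ` E d) (F - {e})"
proof -
  let ?R = "joined E F" and ?R' = "joined (\<lambda>d. h ` E d) (F - {e})"
  have iff: "(h a, h b) \<in> ?R' \<longleftrightarrow> (a, b) \<in> ?R" for a b
    unfolding h_def by (rule joined_merge_iff) (use e F in auto)
  have inV: "?R `` {a} \<subseteq> V" if "a \<in> V" for a
    using joined_local(2)[of F E V a] F that by auto
  have hV: "h ` E d \<subseteq> h ` V" if "d \<in> F" for d using F[OF that] by auto
  have inV': "?R' `` {h a} \<subseteq> h ` V" if "a \<in> V" for a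
    using joined_local(2)[of "F - {e}" "\<lambda>d. h ` E d" "h ` V" "h a"] hV that by auto
  have img: "h ` (?R `` {a}) = ?R' `` {h a}" if "a \<in> V" for a
  proof
    show "h ` (?R `` {a}) \<subseteq> ?R' `` {h a}" using iff by auto
    show "?R' `` {h a} \<subseteq> h ` (?R `` {a})"
    proof
      fix c assume c: "c \<in> ?R' `` {h a}"
      then obtain b where "b \<in> V" "c = h b" using inV'[OF \<open>a \<in> V\<close>] by auto
      then show "c \<in> h ` (?R `` {a})" using c iff by auto
    qed
  qed
  \<comment> \<open>Classes are saturated for \<open>h\<close>: membership can be tested on images.
    Hence distinct classes have distinct images, and an edge lies in a class iff its image lies in
    the image of the class.\<close>
  have sat: "b \<in> K \<longleftrightarrow> h b \<in> h ` K" if K: "K \<in> V // ?R" for K b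
  proof -
    obtain a where a: "a \<in> V" "K = ?R `` {a}" using K by (auto elim: quotientE)
    then show ?thesis using img[OF a(1)] iff by auto
  qed
  have quot: "(h ` V) // ?R' = (`) h ` (V // ?R)"
    unfolding quotient_def using img by auto
  have inj: "inj_on ((`) h) (V // ?R)"
    by (intro inj_onI set_eqI) (use sat in blast)
  let ?m = "\<lambda>K. card {d\<in>F. E d \<subseteq> K}"
  let ?m' = "\<lambda>K. card {d\<in>F - {e}. h ` E d \<subseteq> h ` K}"
  have edges: "{d\<in>F - {e}. h ` E d \<subseteq> h ` K} = {d\<in>F. E d \<subseteq> K} - {e}" if "K \<in> V // ?R" for K
    using sat[OF that] by blast
  define K0 where "K0 = ?R `` {u}"
  have uV: "u \<in> V" using F e by auto
  then have K0: "K0 \<in> V // ?R" unfolding K0_def by (rule quotientI)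
  have eK0: "E e \<subseteq> K0" unfolding K0_def using joined_ends e F by (metis Image_singleton_iff subsetI)
  have whole: "E d' \<subseteq> K" if K: "K \<in> V // ?R" and d': "d' \<in> F" "E d' \<inter> K \<noteq> {}" for d' K
  proof -
    obtain a where a: "K = ?R `` {a}" using K by (auto elim: quotientE)
    obtain p where p: "p \<in> E d'" "p \<in> K" using d' by auto
    show ?thesis
    proof
      fix q assume "q \<in> E d'"
      then have "(p, q) \<in> ?R" using joined_ends d' F p by metis
      then show "q \<in> K" using p a joined_trans by (metis Image_singleton_iff)
    qed
  qed
  have dK0: "E d \<subseteq> K0" using whole[OF K0 d(1)] d(3) eK0 by auto
  have "card ({d\<in>F. E d \<subseteq> K0} - {e}) \<noteq> 0" using fin d dK0 by auto
  moreover have "?m K0 = Suc (card ({d\<in>F. E d \<subseteq> K0} - {e}))"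
    using fin e eK0 by (intro card.remove) auto
  ultimately have w0: "weight x y z (?m K0) = y * weight x y z (?m' K0)"
    using edges[OF K0] weight_Suc_Suc by (metis not0_implies_Suc)
  have w: "weight x y z (?m K) = weight x y z (?m' K)" if K: "K \<in> V // ?R - {K0}" for K
  proof -
    have "K \<inter> K0 = {}"
      using K K0 quotient_disj[OF equiv_joined[of E F], of K K0] unfolding quotient_def by auto
    then have "\<not> E e \<subseteq> K" using eK0 e by auto
    then have "{d\<in>F. E d \<subseteq> K} - {e} = {d\<in>F. E d \<subseteq> K}" by auto
    then show ?thesis using edges K by simp
  qed
  have finq: "finite (V // ?R)" using fin unfolding quotient_def by auto
  have "comp_prod x y z (h ` V) (\<lambda>d. h ` E d) (F - {e}) = (\<Prod>K\<in>V // ?R. weight x y z (?m' K))"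
    unfolding comp_prod_def quot by (rule prod.reindex[OF inj, unfolded comp_def])
  also have "\<dots> = weight x y z (?m' K0) * (\<Prod>K\<in>V // ?R - {K0}. weight x y z (?m' K))"
    by (rule prod.remove[OF finq K0])
  finally have "y * comp_prod x y z (h ` V) (\<lambda>d. h ` E d) (F - {e}) =
      weight x y z (?m K0) * (\<Prod>K\<in>V // ?R - {K0}. weight x y z (?m K))"
    using w0 w by simp
  also have "\<dots> = comp_prod x y z V E F"
    unfolding comp_prod_def by (rule prod.remove[OF finq K0, symmetric])
  finally show ?thesis by simp
qed

text \<open>Here \<open>e\<close> and its ends form a component of weight \<open>x * y + z\<close>,
  which contraction turns into an isolated vertex of weight \<open>x\<close>. With \<open>?r\<close>
  the product over the remaining components, the claim is
  \<open>(x * y + z) * ?r = y * (x * ?r) + z * ?r\<close>.\<close>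

lemma comp_prod_extract:
  assumes fin: "finite V" "finite F"
    and F: "\<And>d. d \<in> F \<Longrightarrow> E d \<subseteq> V \<and> card (E d) \<in> {1, 2}"
    and e: "e \<in> F" "u \<in> E e" and disj: "\<And>d. d \<in> F - {e} \<Longrightarrow> E d \<inter> E e = {}"
  defines "h \<equiv> merge (E e) u"
  shows "comp_prod x y z V E F = y * comp_prod x y z (h ` V) (\<lambda>d. h ` E d) (F - {e})
           + z * comp_prod x y z (V - E e) E (F - {e})"
proof -
  let ?r = "comp_prod x y z (V - E e) E (F - {e})"
  have nonempty: "E d \<noteq> {}" if "d \<in> F" for d using F[OF that] by auto
  have eV: "E e \<subseteq> V" using F e by auto
  have "comp_prod x y z (E e \<union> (V - E e)) E ({e} \<union> (F - {e})) = comp_prod x y z (E e) E {e} * ?r"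
    by (rule comp_prod_Un) (use fin eV F disj e nonempty in \<open>auto intro: finite_subset\<close>)
  moreover have "E e \<union> (V - E e) = V" "{e} \<union> (F - {e}) = F" using eV e by auto
  moreover have "comp_prod x y z (E e) E {e} = weight x y z (card {e})"
    by (rule comp_prod_connected) (use e F joined_ends[of e "{e}" E] in auto)
  ultimately have 1: "comp_prod x y z V E F = (x * y + z) * ?r"
    by (simp add: weight_def)
  have same: "h ` E d = E d" if "d \<in> F - {e}" for d
    using disj[OF that] unfolding h_def merge_def by (auto simp: image_iff)
  have hV: "h ` V = {u} \<union> (V - E e)"
    using eV e unfolding h_def merge_def by auto
  have "comp_prod x y z (h ` V) (\<lambda>d. h ` E d) (F - {e}) = comp_prod x y z (h ` V) E (F - {e})"
    by (rule comp_prod_cong) (rule same)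
  also have "\<dots> = comp_prod x y z ({u} \<union> (V - E e)) E ({} \<union> (F - {e}))"
    using hV by simp
  also have "\<dots> = comp_prod x y z {u} E {} * ?r"
    by (rule comp_prod_Un) (use fin F disj e nonempty in auto)
  also have "comp_prod x y z {u} E {} = weight x y z 0"
    using comp_prod_connected[of "{u}" E "{}"] by (simp add: joined_refl)
  finally have "comp_prod x y z (h ` V) (\<lambda>d. h ` E d) (F - {e}) = x * ?r"
    by (simp add: weight_def)
  then show ?thesis using 1 by (simp add: algebra_simps)
qed

section \<open>The state sum solves the defining equations\<close>

definition state_sum :: "('v, 'e) multigraph \<Rightarrow> real \<Rightarrow> real \<Rightarrow> real \<Rightarrow> real" where
  "state_sum G x y z = (\<Sum>F\<in>Pow (edges G). comp_prod x y z (verts G) (ends G) F)"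

lemma multigraph_delete: "multigraph G \<Longrightarrow> multigraph (delete_edge G e)"
  unfolding multigraph_def delete_edge_def by auto

lemma contract_edge_merge:
  "contract_edge G e u = \<lparr>verts = merge (ends G e) u ` verts G, edges = edges G - {e},
     ends = (\<lambda>d. merge (ends G e) u ` ends G d)\<rparr>"
  unfolding contract_edge_def Let_def merge_def by simp

lemma card_image_1_or_2:
  assumes "card S \<in> {1, 2}" shows "card (h ` S) \<in> {1, 2}"
proof -
  have "finite S" "S \<noteq> {}" using assms by (auto intro: card_ge_0_finite)
  then have "card (h ` S) \<noteq> 0" "card (h ` S) \<le> card S" by (auto intro: card_image_le)
  then show ?thesis using assms by auto
qed

lemma multigraph_contract:
  assumes "multigraph G" shows "multigraph (contract_edge G e u)"
proof -
  have "merge (ends G e) u ` ends G d \<subseteq> merge (ends G e) u ` verts G \<and>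
      card (merge (ends G e) u ` ends G d) \<in> {1, 2}" if "d \<in> edges G" for d
    using assms that card_image_1_or_2[of "ends G d"] unfolding multigraph_def by blast
  then show ?thesis using assms unfolding multigraph_def contract_edge_merge by auto
qed

lemma multigraph_extract: "multigraph G \<Longrightarrow> multigraph (extract_edge G e)"
  unfolding multigraph_def extract_edge_def by auto

lemma multigraph_union:
  "multigraph G \<Longrightarrow> multigraph H \<Longrightarrow> multigraph (graph_union G H)"
  unfolding multigraph_def graph_union_def by auto

text \<open>Subsets avoiding \<open>e\<close> give the deletion term. A subset
  \<open>insert e F\<close> always gives a contraction term, and an extraction term as well exactly
  when \<open>F\<close> avoids the ends of \<open>e\<close>, that is, when \<open>F\<close> consists
  of edges of the extracted graph.\<close>

lemma state_sum_edge:
  assumes G: "multigraph G" and e: "e \<in> edges G" "u \<in> ends G e"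
  shows "state_sum G x y z = state_sum (delete_edge G e) x y z
           + y * state_sum (contract_edge G e u) x y z + z * state_sum (extract_edge G e) x y z"
proof -
  let ?V = "verts G" and ?E = "ends G" and ?X = "edges G"
  let ?h = "merge (?E e) u"
  let ?N = "{d\<in>?X. ?E d \<inter> ?E e = {}}"
  have fin: "finite ?V" "finite ?X" and ends: "\<And>d. d \<in> ?X \<Longrightarrow> ?E d \<subseteq> ?V \<and> card (?E d) \<in> {1, 2}"
    using G unfolding multigraph_def by auto
  have eN: "e \<notin> ?N" using e by auto
  have ins: "comp_prod x y z ?V ?E (insert e F) =
      y * comp_prod x y z (?h ` ?V) (\<lambda>d. ?h ` ?E d) F
      + (if F \<subseteq> ?N then z * comp_prod x y z (?V - ?E e) ?E F else 0)"
    if F: "F \<in> Pow (?X - {e})" for F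
  proof -
    have finF: "finite (insert e F)" using F fin by (auto intro: finite_subset)
    have endsF: "?E d \<subseteq> ?V \<and> card (?E d) \<in> {1, 2}" if "d \<in> insert e F" for d
      using ends[of d] that F e by auto
    have F': "insert e F - {e} = F" using F by auto
    show ?thesis
    proof (cases "F \<subseteq> ?N")
      case True
      then show ?thesis
        using comp_prod_extract[of ?V "insert e F" ?E e u x y z] fin finF endsF e(2) F' by auto
    next
      case False
      then obtain d where "d \<in> F" "?E d \<inter> ?E e \<noteq> {}" using F by auto
      then show ?thesis
        using comp_prod_contract[of ?V "insert e F" ?E e u d x y z] fin finF endsF e(2) F F' False
        by auto
    qed
  qed
  let ?P = "Pow (?X - {e})"
  have finP: "finite ?P" using fin by simp
  have X: "?X = insert e (?X - {e})" using e by auto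
  have "state_sum G x y z = (\<Sum>F\<in>?P \<union> insert e ` ?P. comp_prod x y z ?V ?E F)"
    unfolding state_sum_def by (subst X) (simp only: Pow_insert)
  also have "\<dots> = (\<Sum>F\<in>?P. comp_prod x y z ?V ?E F) + (\<Sum>F\<in>insert e ` ?P. comp_prod x y z ?V ?E F)"
    by (rule sum.union_disjoint) (use finP in auto)
  also have "(\<Sum>F\<in>?P. comp_prod x y z ?V ?E F) = state_sum (delete_edge G e) x y z"
    unfolding state_sum_def delete_edge_def by simp
  also have "(\<Sum>F\<in>insert e ` ?P. comp_prod x y z ?V ?E F) = (\<Sum>F\<in>?P. comp_prod x y z ?V ?E (insert e F))"
  proof -
    have "inj_on (insert e) ?P" by (rule inj_onI) (auto simp: insert_eq_iff)
    then show ?thesis by (simp add: sum.reindex)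
  qed
  also have "\<dots> = (\<Sum>F\<in>?P. y * comp_prod x y z (?h ` ?V) (\<lambda>d. ?h ` ?E d) F)
      + (\<Sum>F\<in>?P. if F \<subseteq> ?N then z * comp_prod x y z (?V - ?E e) ?E F else 0)"
    using ins by (simp add: sum.distrib)
  also have "(\<Sum>F\<in>?P. y * comp_prod x y z (?h ` ?V) (\<lambda>d. ?h ` ?E d) F)
      = y * state_sum (contract_edge G e u) x y z"
    unfolding state_sum_def contract_edge_merge by (simp add: sum_distrib_left)
  \<comment> \<open>The nonzero terms are indexed by subsets of \<open>?N\<close>, the edge set of
    \<open>extract_edge G e\<close>.\<close>
  also have "(\<Sum>F\<in>?P. if F \<subseteq> ?N then z * comp_prod x y z (?V - ?E e) ?E F else 0)
      = (\<Sum>F\<in>Pow ?N. z * comp_prod x y z (?V - ?E e) ?E F)"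
    using finP eN by (intro sum.mono_neutral_cong_right) auto
  also have "\<dots> = z * state_sum (extract_edge G e) x y z"
    unfolding state_sum_def extract_edge_def by (simp add: sum_distrib_left)
  finally show ?thesis by simp
qed

text \<open>Edge subsets of the union are uniquely \<open>A \<union> B\<close> with \<open>A\<close>
  and \<open>B\<close> from the two parts, and \<open>comp_prod_Un\<close> factors each
  summand.\<close>

lemma state_sum_union:
  assumes G: "multigraph G" and H: "multigraph H" and disj: "disjoint_graphs G H"
  shows "state_sum (graph_union G H) x y z = state_sum G x y z * state_sum H x y z"
proof -
  let ?E = "\<lambda>e. if e \<in> edges G then ends G e else ends H e"
  let ?V = "verts G \<union> verts H"
  have split: "comp_prod x y z ?V ?E (A \<union> B)
      = comp_prod x y z (verts G) (ends G) A * comp_prod x y z (verts H) (ends H) B"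
    if A: "A \<in> Pow (edges G)" and B: "B \<in> Pow (edges H)" for A B
  proof -
    have nB: "d \<notin> edges G" if "d \<in> B" for d
      using that B disj unfolding disjoint_graphs_def by auto
    have "comp_prod x y z ?V ?E (A \<union> B)
        = comp_prod x y z (verts G) ?E A * comp_prod x y z (verts H) ?E B"
    proof (rule comp_prod_Un)
      show "finite (verts G)" "finite (verts H)" "verts G \<inter> verts H = {}"
        using G H disj unfolding multigraph_def disjoint_graphs_def by auto
      show "?E d \<subseteq> verts G \<and> ?E d \<noteq> {}" if "d \<in> A" for d
        using G A that unfolding multigraph_def by fastforce
      show "?E d \<subseteq> verts H \<and> ?E d \<noteq> {}" if "d \<in> B" for d
        using H B that nB[OF that] unfolding multigraph_def by fastforce
    qed
    also have "comp_prod x y z (verts G) ?E A = comp_prod x y z (verts G) (ends G) A"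
      by (rule comp_prod_cong) (use A in auto)
    also have "comp_prod x y z (verts H) ?E B = comp_prod x y z (verts H) (ends H) B"
      by (rule comp_prod_cong) (use nB in auto)
    finally show ?thesis .
  qed
  let ?u = "\<lambda>(A, B). A \<union> B"
  have "bij_betw ?u (Pow (edges G) \<times> Pow (edges H)) (Pow (edges G \<union> edges H))"
  proof (rule bij_betw_byWitness[where f' = "\<lambda>F. (F \<inter> edges G, F \<inter> edges H)"])
    show "\<forall>a\<in>Pow (edges G) \<times> Pow (edges H). (\<lambda>F. (F \<inter> edges G, F \<inter> edges H)) (?u a) = a"
      using disj unfolding disjoint_graphs_def by auto
  qed auto
  then have "state_sum (graph_union G H) x y z
      = (\<Sum>a\<in>Pow (edges G) \<times> Pow (edges H). comp_prod x y z ?V ?E (?u a))"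
    unfolding state_sum_def graph_union_def by (simp add: sum.reindex_bij_betw)
  also have "\<dots> = (\<Sum>(A, B)\<in>Pow (edges G) \<times> Pow (edges H).
      comp_prod x y z (verts G) (ends G) A * comp_prod x y z (verts H) (ends H) B)"
    by (rule sum.cong) (use split in auto)
  finally show ?thesis
    unfolding state_sum_def by (simp add: sum_product sum.cartesian_product)
qed

text \<open>The restriction selects the extensional solution required by \<open>xi\<close>. All
  graphs in the equations are again multigraphs, so it does not affect the values involved.\<close>

lemma edge_elimination_state_sum: "edge_elimination (restrict state_sum {G. multigraph G})"
  unfolding edge_elimination_def
proof (intro allI conjI impI)
  fix x y z :: real and G H :: "('v, 'e) multigraph" and v u :: 'v and e :: 'e
  let ?f = "restrict state_sum {G :: ('v, 'e) multigraph. multigraph G}"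
  show "?f G x y z = 1" if "multigraph G \<and> verts G = {}"
  proof -
    have "edges G = {}"
      using that unfolding multigraph_def by fastforce
    then show ?thesis using that by (simp add: state_sum_def comp_prod_empty)
  qed
  show "?f G x y z = x" if "multigraph G \<and> verts G = {v} \<and> edges G = {}"
  proof -
    have "comp_prod x y z {v} (ends G) {} = weight x y z (card ({} :: 'e set))"
      by (rule comp_prod_connected) (auto simp: joined_refl)
    then show ?thesis using that by (simp add: state_sum_def weight_def)
  qed
  show "?f G x y z = ?f (delete_edge G e) x y z + y * ?f (contract_edge G e u) x y z
      + z * ?f (extract_edge G e) x y z" if "multigraph G \<and> e \<in> edges G \<and> u \<in> ends G e"
    using that state_sum_edge[of G e u]
    by (simp add: multigraph_delete multigraph_contract multigraph_extract)
  show "?f (graph_union G H) x y z = ?f G x y z * ?f H x y z"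
    if "multigraph G \<and> multigraph H \<and> disjoint_graphs G H"
    using that state_sum_union[of G H] by (simp add: multigraph_union)
qed

section \<open>Uniqueness of the solution\<close>

context
  fixes f :: "('v, 'e) multigraph \<Rightarrow> real \<Rightarrow> real \<Rightarrow> real \<Rightarrow> real"
  assumes f: "edge_elimination f"
begin

lemma elim_empty: "multigraph G \<Longrightarrow> verts G = {} \<Longrightarrow> f G x y z = 1"
  using f unfolding edge_elimination_def by blast

lemma elim_single: "multigraph G \<Longrightarrow> verts G = {v} \<Longrightarrow> edges G = {} \<Longrightarrow> f G x y z = x"
  using f unfolding edge_elimination_def by blast

lemma elim_edge:
  "multigraph G \<Longrightarrow> e \<in> edges G \<Longrightarrow> u \<in> ends G e \<Longrightarrow>
    f G x y z = f (delete_edge G e) x y z + y * f (contract_edge G e u) x y z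
      + z * f (extract_edge G e) x y z"
  using f unfolding edge_elimination_def by blast

lemma elim_isolated:
  assumes G: "multigraph G" and v: "v \<in> verts G" "\<And>e. e \<in> edges G \<Longrightarrow> v \<notin> ends G e"
  shows "f G x y z = x * f (G\<lparr>verts := verts G - {v}\<rparr>) x y z"
proof -
  let ?A = "\<lparr>verts = {v}, edges = {}, ends = ends G\<rparr>" and ?B = "G\<lparr>verts := verts G - {v}\<rparr>"
  have A: "multigraph ?A" unfolding multigraph_def by simp
  have B: "multigraph ?B" using G v unfolding multigraph_def by auto
  \<comment> \<open>As \<open>?A\<close> has no edges, the union takes all ends from
    \<open>?B\<close>; the equality is literal, so no invariance under isomorphism is
    involved.\<close>
  have "G = graph_union ?A ?B"
    unfolding graph_union_def using v(1) by (auto intro!: multigraph.equality)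
  then have "f G x y z = f (graph_union ?A ?B) x y z" by (rule arg_cong)
  also have "\<dots> = f ?A x y z * f ?B x y z"
    using f A B unfolding edge_elimination_def disjoint_graphs_def by auto
  also have "f ?A x y z = x" using elim_single[OF A, of v] by simp
  finally show ?thesis .
qed

end

text \<open>Deletion, contraction and extraction all lose the edge \<open>e\<close> and gain no
  vertex. The vertex count in the measure handles edgeless graphs, where isolated vertices are split
  off one at a time.\<close>

lemma edge_elimination_unique:
  assumes f: "edge_elimination f" and g: "edge_elimination g" and "multigraph G"
  shows "f G x y z = g G x y z"
  using assms(3)
proof (induction "card (edges G) + card (verts G)" arbitrary: G rule: less_induct)
  case less
  note G = less.prems
  have fin: "finite (verts G)" "finite (edges G)" using G unfolding multigraph_def by auto
  consider "verts G = {}" | v where "v \<in> verts G" "edges G = {}" | e where "e \<in> edges G" by auto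
  then show ?case
  proof cases
    case 1
    then show ?thesis using elim_empty f g G by metis
  next
    case 2
    let ?B = "G\<lparr>verts := verts G - {v}\<rparr>"
    have "multigraph ?B" using G 2 unfolding multigraph_def by auto
    moreover have "card (verts ?B) < card (verts G)" 
      using fin 2 card_Diff1_less[of "verts G" v] by simp
    ultimately have "f ?B x y z = g ?B x y z" using less.hyps[of ?B] by simp
    then show ?thesis using elim_isolated[OF f G, of v] elim_isolated[OF g G, of v] 2 by simp
  next
    case 3
    then obtain u where u: "u \<in> ends G e" using G unfolding multigraph_def by fastforce
    have E: "card (edges G - {e}) < card (edges G)" using fin 3 by (intro card_Diff1_less)
    have 1: "f (delete_edge G e) x y z = g (delete_edge G e) x y z"
      by (rule less.hyps) (use E G in \<open>auto simp: multigraph_delete\<close>, simp add: delete_edge_def)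
    have 2: "f (contract_edge G e u) x y z = g (contract_edge G e u) x y z"
    proof (rule less.hyps)
      have "card (merge (ends G e) u ` verts G) \<le> card (verts G)"
        using fin by (intro card_image_le)
      then show "card (edges (contract_edge G e u)) + card (verts (contract_edge G e u))
          < card (edges G) + card (verts G)"
        using E by (simp add: contract_edge_merge)
    qed (use G in \<open>simp add: multigraph_contract\<close>)
    have "f (extract_edge G e) x y z = g (extract_edge G e) x y z"
    proof (rule less.hyps)
      have "edges (extract_edge G e) \<subseteq> edges G - {e}" using u unfolding extract_edge_def by auto
      then have "card (edges (extract_edge G e)) \<le> card (edges G - {e})"
        using fin by (intro card_mono) auto
      moreover have "card (verts (extract_edge G e)) \<le> card (verts G)"
        using fin unfolding extract_edge_def by (auto intro: card_mono)
      ultimately show "card (edges (extract_edge G e)) + card (verts (extract_edge G e))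
          < card (edges G) + card (verts G)" using E by simp
    qed (use G in \<open>simp add: multigraph_extract\<close>)
    then show ?thesis
      using 1 2 elim_edge[OF f G 3 u] elim_edge[OF g G 3 u] by simp
  qed
qed

text \<open>Existence and uniqueness make the definite description in \<open>xi\<close> meaningful.
  From here on only the equations are used, so the values below are derived for any solution
  \<open>f\<close>.\<close>

lemma edge_elimination_xi: "edge_elimination xi"
proof -
  let ?P = "\<lambda>f :: ('v, 'e) multigraph \<Rightarrow> _. edge_elimination f \<and> f \<in> extensional {G. multigraph G}"
  have "\<exists>!f. ?P f"
  proof (rule ex1I)
    show "?P (restrict state_sum {G. multigraph G})"
      using edge_elimination_state_sum by simp
    fix f :: "('v, 'e) multigraph \<Rightarrow> real \<Rightarrow> real \<Rightarrow> real \<Rightarrow> real"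
    assume f: "?P f"
    show "f = restrict state_sum {G. multigraph G}"
    proof (rule extensionalityI[of _ "{G. multigraph G}"])
      fix G :: "('v, 'e) multigraph" assume "G \<in> {G. multigraph G}"
      then show "f G = restrict state_sum {G. multigraph G} G"
        using edge_elimination_unique[OF _ edge_elimination_state_sum, of f G] f
        by (intro ext) blast
    qed (use f in auto)
  qed
  then show ?thesis unfolding xi_def by (rule theI'[THEN conjunct1])
qed

subsection \<open>Paths and cycles\<close>

text \<open>Simplicity is expressed separately by \<open>distinct vs\<close>. The empty list stands
  for the empty path, which appears when both vertices of a one-edge path are extracted.\<close>

fun is_path :: "('e \<Rightarrow> 'v set) \<Rightarrow> 'v list \<Rightarrow> 'e list \<Rightarrow> bool" where
  "is_path E [] [] \<longleftrightarrow> True"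
| "is_path E [v] [] \<longleftrightarrow> True"
| "is_path E (v # w # vs) (e # es) \<longleftrightarrow> E e = {v, w} \<and> is_path E (w # vs) es"
| "is_path E _ _ \<longleftrightarrow> False"

lemma is_path_Nil [simp]: "is_path E [] es \<longleftrightarrow> es = []"
  by (cases es) auto

lemma is_path_single [simp]: "is_path E [v] es \<longleftrightarrow> es = []"
  by (cases es) auto

lemma is_path_Cons_Cons:
  "is_path E (v # w # vs) es \<longleftrightarrow> (\<exists>d ds. es = d # ds \<and> E d = {v, w} \<and> is_path E (w # vs) ds)"
  by (cases es) auto

lemma is_path_cong:
  "(\<And>d. d \<in> set es \<Longrightarrow> E d = E' d) \<Longrightarrow> is_path E vs es = is_path E' vs es"
  by (induction E vs es rule: is_path.induct) auto

lemma is_path_ends: "is_path E vs es \<Longrightarrow> d \<in> set es \<Longrightarrow> E d \<subseteq> set vs"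
  by (induction E vs es rule: is_path.induct) auto

text \<open>\<open>is_path\<close> recurses from the front; extracting the closing edge of a cycle
  also removes the last path vertex, hence this decomposition at the back.\<close>

lemma is_path_snoc:
  "is_path E (xs @ [l]) es \<Longrightarrow> xs \<noteq> [] \<Longrightarrow> \<exists>ds d. es = ds @ [d] \<and> l \<in> E d \<and> is_path E xs ds"
proof (induction xs arbitrary: es)
  case (Cons a xs)
  show ?case
  proof (cases xs)
    case Nil
    then show ?thesis using Cons.prems by (auto simp: is_path_Cons_Cons)
  next
    case (Cons b ys)
    then obtain d ds where d: "es = d # ds" "E d = {a, b}" "is_path E (xs @ [l]) ds"
      using Cons.prems by (auto simp: is_path_Cons_Cons)
    then obtain ds' d' where "ds = ds' @ [d']" "l \<in> E d'" "is_path E xs ds'"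
      using Cons.IH Cons by blast
    then show ?thesis using d Cons by (intro exI[of _ "d # ds'"] exI[of _ d']) simp
  qed
qed simp

lemma is_path_card2:
  "is_path E vs es \<Longrightarrow> distinct vs \<Longrightarrow> d \<in> set es \<Longrightarrow> card (E d) = 2"
  by (induction E vs es rule: is_path.induct) auto

lemma is_path_incidence:
  assumes "is_path E vs es" "distinct vs" "es \<noteq> []" "v \<in> set vs"
  shows "card {d\<in>set es. v \<in> E d} = (if v = hd vs \<or> v = last vs then 1 else 2)"
  using assms
proof (induction vs arbitrary: es)
  case (Cons a us)
  show ?case
  proof (cases us)
    case Nil
    then show ?thesis using Cons.prems by auto
  next
    case us: (Cons b ws)
    then obtain e ds where e: "es = e # ds" "E e = {a, b}" "is_path E us ds"
      using Cons.prems by (auto simp: is_path_Cons_Cons)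
    have a: "a \<notin> E d" if "d \<in> set ds" for d
      using is_path_ends[OF e(3) that] Cons.prems(2) by auto
    then have e_ds: "e \<notin> set ds" using e(2) by auto
    have split: "{d\<in>set es. v \<in> E d} = (if v \<in> {a, b} then {e} else {}) \<union> {d\<in>set ds. v \<in> E d}"
      using e by auto
    show ?thesis
    proof (cases "v = a")
      case True
      then have "{d\<in>set es. v \<in> E d} = {e}" unfolding split using a by auto
      then show ?thesis using True by simp
    next
      case False
      then have v: "v \<in> set us" using Cons.prems by simp
      show ?thesis
      proof (cases "ds = []")
        case True
        then have "ws = []" using e(3) us by (cases ws) auto
        then have "v = b" "{d\<in>set es. v \<in> E d} = {e}" using True v e us by auto
        then show ?thesis using us \<open>ws = []\<close> by simp
      next
        case ds: False
        then have "ws \<noteq> []" using e(3) us by auto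
        then have "b \<noteq> last us" using Cons.prems(2) us by auto
        moreover have "card {d\<in>set ds. v \<in> E d} = (if v = b \<or> v = last us then 1 else 2)"
          using Cons.IH[OF e(3) _ ds v] Cons.prems(2) us by simp
        ultimately show ?thesis
          unfolding split using False e_ds us by (auto simp: card_insert_if)
      qed
    qed
  qed
qed simp

section \<open>Values on paths and cycles\<close>

fun path_poly :: "real \<Rightarrow> real \<Rightarrow> real \<Rightarrow> nat \<Rightarrow> real" where
  "path_poly x y z 0 = 1"
| "path_poly x y z (Suc 0) = x"
| "path_poly x y z (Suc (Suc n)) = (x + y) * path_poly x y z (Suc n) + z * path_poly x y z n"

text \<open>At one vertex, deleting and contracting the loop both leave a single vertex, and
  extracting it leaves the empty graph: \<open>x + y * x + z * 1\<close>. The general step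
  eliminates the closing edge.\<close>

fun cycle_poly :: "real \<Rightarrow> real \<Rightarrow> real \<Rightarrow> nat \<Rightarrow> real" where
  "cycle_poly x y z 0 = 1"
| "cycle_poly x y z (Suc 0) = x + x * y + z"
| "cycle_poly x y z (Suc (Suc n)) =
     path_poly x y z (Suc (Suc n)) + y * cycle_poly x y z (Suc n) + z * path_poly x y z n"

text \<open>The first edge \<open>{a, b}\<close> is eliminated. Deletion isolates \<open>a\<close>
  and contributes \<open>x\<close> times the path from \<open>b\<close>; contraction contributes
  \<open>y\<close> times that path; extraction leaves the path without \<open>a\<close> and
  \<open>b\<close>.\<close>

lemma path_value:
  assumes f: "edge_elimination f"
    and "multigraph G" "verts G = set vs" "edges G = set es" "distinct vs" "is_path (ends G) vs es"
  shows "f G x y z = path_poly x y z (length vs)"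
  using assms(2-)
proof (induction "length vs" arbitrary: G vs es rule: less_induct)
  case less
  note G = \<open>multigraph G\<close>
  consider "vs = []" | a where "vs = [a]" | a b ws where "vs = a # b # ws"
    by (metis list.exhaust)
  then show ?case
  proof cases
    case 1
    then show ?thesis using elim_empty[OF f G] less.prems by simp
  next
    case 2
    then show ?thesis using elim_single[OF f G] less.prems by simp
  next
    case 3
    then obtain e ds where e: "es = e # ds" "ends G e = {a, b}" "is_path (ends G) (b # ws) ds"
      using less.prems by (auto simp: is_path_Cons_Cons)
    have a: "a \<notin> ends G d" if "d \<in> set ds" for d
      using is_path_ends[OF e(3) that] less.prems(4) 3 by auto
    then have e_ds: "e \<notin> set ds" using e(2) by auto
    let ?D = "delete_edge G e" and ?K = "contract_edge G e b" and ?X = "extract_edge G e"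
    let ?D' = "?D\<lparr>verts := verts ?D - {a}\<rparr>"
    have D: "verts ?D = set vs" "edges ?D = set ds" "ends ?D = ends G"
      using less.prems e e_ds by (auto simp: delete_edge_def)
    have "f ?D x y z = x * f ?D' x y z"
      by (rule elim_isolated[OF f multigraph_delete[OF G]]) (use 3 D a in auto)
    also have "f ?D' x y z = path_poly x y z (length (b # ws))"
    proof (rule less.hyps)
      show "multigraph ?D'"
        using multigraph_delete[OF G, of e] D a unfolding multigraph_def by auto
      show "verts ?D' = set (b # ws)" using D 3 less.prems(4) by auto
      show "edges ?D' = set ds" "is_path (ends ?D') (b # ws) ds" using D e by auto
    qed (use 3 less.prems(4) in auto)
    finally have 1: "f ?D x y z = x * path_poly x y z (Suc (length ws))" by simp
    have "f ?K x y z = path_poly x y z (length (b # ws))"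
    proof (rule less.hyps)
      show "verts ?K = set (b # ws)"
        using less.prems(2,4) 3 e(2) by (auto simp: contract_edge_merge merge_def)
      show "edges ?K = set ds" using less.prems e e_ds by (auto simp: contract_edge_merge)
      \<comment> \<open>No later edge contains \<open>a\<close>, and the merged vertex keeps the
        name \<open>b\<close>, so all remaining ends are literally unchanged.\<close>
      have "ends ?K d = ends G d" if "d \<in> set ds" for d
        using a[OF that] e(2) by (auto simp: contract_edge_merge merge_def image_iff)
      then show "is_path (ends ?K) (b # ws) ds" using e(3) is_path_cong by metis
    qed (use 3 less.prems(4) multigraph_contract[OF G] in auto)
    then have 2: "f ?K x y z = path_poly x y z (Suc (length ws))" by simp
    have "f ?X x y z = path_poly x y z (length ws)"
    proof (rule less.hyps)
      show "verts ?X = set ws"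
        using less.prems(2,4) 3 e(2) by (auto simp: extract_edge_def)
      \<comment> \<open>The second path edge disappears together with \<open>b\<close>, hence
        \<open>tl ds\<close>; if \<open>ws\<close> is empty then so is \<open>ds\<close>, and
        \<open>tl [] = []\<close> fits.\<close>
      have ws: "is_path (ends G) ws (tl ds) \<and> {d\<in>set ds. b \<notin> ends G d} = set (tl ds)"
      proof (cases ws)
        case Nil
        then show ?thesis using e(3) by simp
      next
        case (Cons c us)
        then obtain d' ds' where d': "ds = d' # ds'" "ends G d' = {b, c}" "is_path (ends G) ws ds'"
          using e(3) by (auto simp: is_path_Cons_Cons)
        have "b \<notin> ends G d" if "d \<in> set ds'" for d
          using is_path_ends[OF d'(3) that] less.prems(4) 3 by auto
        then show ?thesis using d' by auto
      qed
      then show "is_path (ends ?X) ws (tl ds)" by (simp add: extract_edge_def)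
      have "edges ?X = {d\<in>set ds. b \<notin> ends G d}"
        using less.prems(3) e a by (auto simp: extract_edge_def)
      then show "edges ?X = set (tl ds)" using ws by simp
    qed (use 3 less.prems(4) multigraph_extract[OF G] in auto)
    then show ?thesis
      using elim_edge[OF f G, of e b] 1 2 e less.prems(3) 3 by (simp add: algebra_simps)
  qed
qed

text \<open>The closing edge is eliminated. Deletion leaves the path \<open>vs\<close>, contraction
  a cycle with one vertex less, and extraction the path without its first and last vertices.\<close>

lemma cycle_value:
  assumes f: "edge_elimination f"
    and "multigraph G" "verts G = set vs" "edges G = insert e (set es)" "e \<notin> set es"
      "vs \<noteq> []" "distinct vs" "is_path (ends G) vs es" "ends G e = {hd vs, last vs}"
  shows "f G x y z = cycle_poly x y z (length vs)"
  using assms(2-)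
proof (induction vs arbitrary: G e es)
  case (Cons a us)
  note G = \<open>multigraph G\<close>
  let ?D = "delete_edge G e" and ?X = "extract_edge G e"
  show ?case
  proof (cases us)
    case Nil
    let ?K = "contract_edge G e a"
    have "f ?D x y z = x"
      by (rule elim_single[OF f multigraph_delete[OF G]]) (use Cons.prems Nil in \<open>auto simp: delete_edge_def\<close>)
    moreover have "f ?K x y z = x"
      by (rule elim_single[OF f multigraph_contract[OF G]])
        (use Cons.prems Nil in \<open>auto simp: contract_edge_merge merge_def\<close>)
    moreover have "f ?X x y z = 1"
      by (rule elim_empty[OF f multigraph_extract[OF G]])
        (use Cons.prems Nil in \<open>auto simp: extract_edge_def\<close>)
    ultimately show ?thesis
      using elim_edge[OF f G, of e a] Cons.prems Nil by simp
  next
    case us: (Cons b ws)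
    define l where "l = last us"
    let ?K = "contract_edge G e l"
    obtain d ds where d: "es = d # ds" "ends G d = {a, b}" "is_path (ends G) us ds"
      using Cons.prems us by (auto simp: is_path_Cons_Cons)
    have a: "a \<notin> ends G c" if "c \<in> set ds" for c
      using is_path_ends[OF d(3) that] Cons.prems by auto
    have endse: "ends G e = {a, l}" using Cons.prems us l_def by simp
    have lus: "l \<in> set us" "b \<in> set us" "a \<notin> set us" "a \<noteq> b"
      using us l_def Cons.prems by auto
    have d_ds: "d \<notin> set ds" using a d(2) by auto
    have "f ?D x y z = path_poly x y z (length (a # us))"
      by (rule path_value[OF f multigraph_delete[OF G], where es = es])
        (use Cons.prems in \<open>auto simp: delete_edge_def\<close>)
    moreover have "f ?K x y z = cycle_poly x y z (length us)"
    proof (rule Cons.IH)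
      show "verts ?K = set us"
        using Cons.prems(2) lus endse by (auto simp: contract_edge_merge merge_def)
      show "edges ?K = insert d (set ds)"
        using Cons.prems(3,4) d(1) by (auto simp: contract_edge_merge)
      have "ends ?K c = ends G c" if "c \<in> set ds" for c
        using a[OF that] endse by (auto simp: contract_edge_merge merge_def image_iff)
      then show "is_path (ends ?K) us ds" using d(3) is_path_cong by metis
      \<comment> \<open>Naming the merged vertex \<open>l\<close> turns the first path edge
        \<open>{a, b}\<close> into \<open>{l, b}\<close>, the closing edge of the shorter cycle. For
        two vertices \<open>l = b\<close>, and it becomes a loop.\<close>
      show "ends ?K d = {hd us, last us}"
        using endse d(2) us l_def lus(4) by (auto simp: contract_edge_merge merge_def)
    qed (use us d_ds Cons.prems multigraph_contract[OF G] in auto)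
    moreover have "f ?X x y z = path_poly x y z (length (butlast us))"
    proof (rule path_value[OF f multigraph_extract[OF G], where es = "butlast ds"])
      have us': "us = butlast us @ [l]" using us l_def by simp
      have dist: "distinct (butlast us)" "l \<notin> set (butlast us)"
        using Cons.prems(6) us' by (metis distinct.simps(2) distinct_append distinct_butlast, 
          metis distinct.simps(2) distinct_append disjoint_insert(1) list.set(2))
      show "distinct (butlast us)" by fact
      show "verts ?X = set (butlast us)"
      proof -
        have "set us = insert l (set (butlast us))" by (subst us') simp
        then show ?thesis using Cons.prems(2) endse dist lus by (auto simp: extract_edge_def)
      qed
      \<comment> \<open>Besides \<open>d\<close>, which meets \<open>a\<close>, extraction removes
        the last path edge, which meets \<open>l\<close>. For \<open>us = [l]\<close> there is none,
        and \<open>butlast [] = []\<close> fits.\<close>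
      have path: "is_path (ends G) (butlast us) (butlast ds) \<and>
          {c\<in>set ds. l \<notin> ends G c} = set (butlast ds)"
      proof (cases "butlast us = []")
        case True
        then have "us = [l]" using us' by simp
        then show ?thesis using d(3) by simp
      next
        case False
        then obtain ds' d' where d': "ds = ds' @ [d']" "l \<in> ends G d'" "is_path (ends G) (butlast us) ds'"
          using is_path_snoc[of "ends G" "butlast us" l ds] d(3) us' by auto
        have "l \<notin> ends G c" if "c \<in> set ds'" for c
          using is_path_ends[OF d'(3) that] dist by auto
        then show ?thesis using d' by auto
      qed
      then show "is_path (ends ?X) (butlast us) (butlast ds)" by (simp add: extract_edge_def)
      have "edges ?X = {c\<in>set ds. l \<notin> ends G c}"
        using Cons.prems(3) d a endse by (auto simp: extract_edge_def)
      then show "edges ?X = set (butlast ds)" using path by simp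
    qed
    ultimately show ?thesis
      using elim_edge[OF f G, of e l] Cons.prems(3) endse us by simp
  qed
qed simp

section \<open>The shape of connected 2-regular graphs\<close>

lemma connected_closed:
  assumes conn: "connected_graph G" and S: "S \<subseteq> verts G" "S \<noteq> {}"
    and closed: "\<And>e. e \<in> edges G \<Longrightarrow> ends G e \<inter> S \<noteq> {} \<Longrightarrow> ends G e \<subseteq> S"
  shows "verts G = S"
proof -
  obtain s where s: "s \<in> S" using S by auto
  have "t \<in> S" if "(s, t) \<in> (adjacency G)\<^sup>*" for t
    using that
  proof (induction rule: rtrancl_induct)
    case (step b c)
    then obtain e where "e \<in> edges G" "ends G e = {b, c}" unfolding adjacency_def by auto
    then show ?case using closed[of e] step.IH by auto
  qed (rule s)
  then show ?thesis using conn s S unfolding connected_graph_def by blast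
qed

text \<open>On a longest path every neighbour of the first vertex \<open>a\<close> lies on the path.
  Degree 2 provides an edge \<open>e\<close> at \<open>a\<close> outside the path; inner path
  vertices already have their two edges, so \<open>e\<close> ends at the last vertex. Now no further
  edge touches the path, and connectivity makes it the whole graph.\<close>

lemma is_cycle_path:
  assumes "is_cycle n G"
  obtains vs es e where "length vs = n" "verts G = set vs" "edges G = insert e (set es)"
    "e \<notin> set es" "vs \<noteq> []" "distinct vs" "is_path (ends G) vs es" "ends G e = {hd vs, last vs}"
proof -
  let ?E = "ends G"
  let ?I = "\<lambda>v. {e\<in>edges G. v \<in> ?E e}" and ?L = "\<lambda>v. {e\<in>edges G. ?E e = {v}}"
  have conn: "connected_graph G" and n: "card (verts G) = n"
    and fin: "finite (verts G)" "finite (edges G)"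
    and ends: "\<And>e. e \<in> edges G \<Longrightarrow> ?E e \<subseteq> verts G \<and> card (?E e) \<in> {1, 2}"
    and deg: "\<And>v. v \<in> verts G \<Longrightarrow> card (?I v) + card (?L v) = 2"
    using assms unfolding is_cycle_def multigraph_def regular_def degree_def by auto
  have nonempty: "?E e \<noteq> {}" if "e \<in> edges G" for e using ends[OF that] by auto
  define P where "P k \<longleftrightarrow> (\<exists>vs es. length vs = k \<and> distinct vs \<and> set vs \<subseteq> verts G \<and>
      set es \<subseteq> edges G \<and> is_path ?E vs es)" for k
  obtain v0 where v0: "v0 \<in> verts G" using conn unfolding connected_graph_def by auto
  have P1: "P 1" unfolding P_def by (rule exI[of _ "[v0]"]) (use v0 in auto)
  have bound: "\<forall>k. P k \<longrightarrow> k \<le> card (verts G)"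
    unfolding P_def using fin by (metis card_mono distinct_card)
  obtain k where k: "P k" "\<And>j. P j \<Longrightarrow> j \<le> k"
    using GreatestI_nat[of P, OF P1] Greatest_le_nat[of P] bound by metis
  then obtain vs es where p: "length vs = k" "distinct vs" "set vs \<subseteq> verts G" "set es \<subseteq> edges G"
    "is_path ?E vs es" unfolding P_def by blast
  have "k \<ge> 1" using k(2) P1 .
  then have vs: "vs \<noteq> []" using p(1) by auto
  define a where "a = hd vs"
  have a: "a \<in> set vs" "vs = a # tl vs" using vs a_def by auto
  have longest: "w \<in> set vs" if "e \<in> edges G" "?E e = {w, a}" for e w
  proof (rule ccontr)
    assume w: "w \<notin> set vs"
    have "is_path ?E (w # vs) (e # es)"
      using that p(5) a(2) is_path.simps(3)[of ?E w a "tl vs" e es] by simp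
    moreover have "w \<in> verts G" using ends[OF that(1)] that(2) by auto
    ultimately have "P (Suc k)" unfolding P_def
      using p that w by (intro exI[of _ "w # vs"] exI[of _ "e # es"]) auto
    then show False using k(2)[of "Suc k"] by simp
  qed
  have other: "\<exists>w. ?E e = {w, a} \<and> w \<noteq> a" if "e \<in> ?I a" "?E e \<noteq> {a}" for e
  proof -
    have "card (?E e) = 2 \<or> card (?E e) = 1" using ends that by auto
    then show ?thesis using that by (auto simp: card_2_iff card_1_singleton_iff doubleton_eq_iff)
  qed
  have "\<exists>e. edges G = insert e (set es) \<and> verts G = set vs \<and> e \<notin> set es \<and> ?E e = {hd vs, last vs}"
  proof (cases "es = []")
    case True
    then have vs_a: "vs = [a]" using p(5) a(2) by (cases "tl vs") (auto simp: is_path_Cons_Cons)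
    have loop: "?E e = {a}" if "e \<in> ?I a" for e
      using other[OF that] longest[of e] that vs_a by auto
    \<comment> \<open>Every edge at \<open>a\<close> is a loop and is counted twice in the degree,
      so degree 2 means exactly one loop.\<close>
    have "?I a = ?L a"
    proof
      show "?I a \<subseteq> ?L a" using loop by blast
    qed auto
    then have "card (?I a) = 1" using deg[of a] a p(3) by auto
    then obtain e where e: "?I a = {e}" by (auto simp: card_1_singleton_iff)
    have V: "verts G = set vs"
    proof (rule connected_closed[OF conn p(3)])
      show "set vs \<noteq> {}" using vs by simp
      fix c assume "c \<in> edges G" "?E c \<inter> set vs \<noteq> {}"
      then have "c \<in> ?I a" using vs_a by auto
      then have "?E c = {a}" by (rule loop)
      then show "?E c \<subseteq> set vs" using vs_a by simp
    qed
    have "c \<in> ?I a" if "c \<in> edges G" for c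
      using ends[OF that] nonempty[OF that] that V vs_a by auto
    then have "edges G = ?I a" by auto
    then have E: "edges G = {e}" using e by simp
    have "e \<in> ?I a" unfolding e by simp
    then have "?E e = {a}" by (rule loop)
    then have "edges G = insert e (set es) \<and> verts G = set vs \<and> e \<notin> set es \<and>
        ?E e = {hd vs, last vs}" using True E V vs_a by simp
    then show ?thesis ..
  next
    case False
    \<comment> \<open>Each vertex of the path lies on a path edge, which is not a loop, so
      \<open>?L v\<close> is strictly smaller than \<open>?I v\<close>; a sum of 2 then forces the
      sizes 0 and 2.\<close>
    have two: "card (?I v) = 2 \<and> ?L v = {}" if "v \<in> set vs" for v
    proof -
      have "card {d\<in>set es. v \<in> ?E d} \<noteq> 0"
        using is_path_incidence[OF p(5,2) False that] by auto
      then have "{d\<in>set es. v \<in> ?E d} \<noteq> {}" by (metis card.empty)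
      then obtain d where d: "d \<in> set es" "v \<in> ?E d" by auto
      then have "d \<in> ?I v" "d \<notin> ?L v" using is_path_card2[OF p(5,2) d(1)] p(4) by auto
      moreover have "?L v \<subseteq> ?I v" by auto
      ultimately have "?L v \<subset> ?I v" by (metis psubsetI)
      then have "card (?L v) < card (?I v)" using fin by (intro psubset_card_mono) auto
      then have "card (?L v) = 0" "card (?I v) = 2" using deg[of v] that p(3) by auto
      then show ?thesis using fin by auto
    qed
    let ?J = "\<lambda>v. {d\<in>set es. v \<in> ?E d}"
    have J: "?J v \<subseteq> ?I v" "finite (?I v)" for v using p(4) fin by auto
    have "card (?J a) = 1" using is_path_incidence[OF p(5,2) False a(1)] a_def by simp
    then have "?J a \<noteq> ?I a" using two[OF a(1)] by auto
    then obtain e where e: "e \<in> ?I a" "e \<notin> set es" using J by auto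
    then obtain w where w: "?E e = {w, a}" "w \<noteq> a" using other two[OF a(1)] by blast
    have wvs: "w \<in> set vs" using longest e w by auto
    \<comment> \<open>At an end of \<open>e\<close>, the edge \<open>e\<close> and one path edge
      already exhaust the two available incidences.\<close>
    have sat: "?I v = insert e (?J v)" if "v \<in> set vs" "v \<in> ?E e" for v
    proof -
      have "card (?J v) \<ge> 1" using is_path_incidence[OF p(5,2) False that(1)] by auto
      then have "card (insert e (?J v)) \<ge> 2" using e by simp
      moreover have "insert e (?J v) \<subseteq> ?I v" using J e that by auto
      ultimately show ?thesis using card_seteq[of "?I v" "insert e (?J v)"] J two[OF that(1)] by auto
    qed
    have w_last: "w = last vs"
    proof (rule ccontr)
      \<comment> \<open>Then \<open>w\<close> is an inner vertex: two path edges and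
        \<open>e\<close> would make three incidences.\<close>
      assume "w \<noteq> last vs"
      then have "card (?J w) = 2" using is_path_incidence[OF p(5,2) False wvs] w(2) a_def by simp
      then have "card (insert e (?J w)) = 3" using e by simp
      then show False using sat[OF wvs] w two[OF wvs] by auto
    qed
    have inc: "?I v \<subseteq> insert e (set es)" if "v \<in> set vs" for v
    proof (cases "v \<in> ?E e")
      case True
      then show ?thesis using sat[OF that] by auto
    next
      case nv: False
      \<comment> \<open>A vertex off \<open>e\<close> is neither first nor last, so both its edges
        belong to the path.\<close>
      then have "card (?J v) = 2"
        using is_path_incidence[OF p(5,2) False that] w w_last a_def by auto
      then have "?J v = ?I v" using card_seteq[of "?I v" "?J v"] J two[OF that] by auto
      then show ?thesis by auto
    qed
    have V: "verts G = set vs"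
    proof (rule connected_closed[OF conn p(3)])
      show "set vs \<noteq> {}" using vs by simp
      fix c assume "c \<in> edges G" "?E c \<inter> set vs \<noteq> {}"
      then have "c \<in> insert e (set es)" using inc by auto
      then show "?E c \<subseteq> set vs" using is_path_ends[OF p(5)] w wvs a(1) by auto
    qed
    have "edges G \<subseteq> insert e (set es)"
    proof
      fix c assume c: "c \<in> edges G"
      then obtain v where "v \<in> ?E c" using nonempty by auto
      then show "c \<in> insert e (set es)" using c ends[OF c] V inc by auto
    qed
    then have "edges G = insert e (set es)" using e p(4) by auto
    then show ?thesis using V e w w_last a_def by auto
  qed
  then obtain e where e: "edges G = insert e (set es)" "verts G = set vs" "e \<notin> set es"
    "?E e = {hd vs, last vs}" by blast
  then have "length vs = n" using n p(2) distinct_card by metis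
  then show thesis using that e vs p by blast
qed

subsection \<open>Solving the recurrences\<close>

text \<open>The generalized Lucas sequence: the sum of the \<open>n\<close>-th powers of the roots
  of \<open>t^2 - p * t - q\<close>.\<close>

fun lucas :: "real \<Rightarrow> real \<Rightarrow> nat \<Rightarrow> real" where
  "lucas p q 0 = 2"
| "lucas p q (Suc 0) = p"
| "lucas p q (Suc (Suc n)) = p * lucas p q (Suc n) + q * lucas p q n"

text \<open>Both sides satisfy the recurrence with coefficients \<open>x + y\<close> and
  \<open>z\<close>, so the first two values decide. The right side is what deletion and extraction
  of the closing edge contribute to \<open>cycle_poly\<close>.\<close>

lemma lucas_path_poly:
  "lucas (x + y) z (Suc (Suc n)) - y * lucas (x + y) z (Suc n)
     = path_poly x y z (Suc (Suc n)) + z * path_poly x y z n"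
proof (induction "x + y" z n rule: lucas.induct)
  case (3 q n)
  have "lucas (x + y) q (Suc (Suc (Suc (Suc n)))) - y * lucas (x + y) q (Suc (Suc (Suc n)))
      = (x + y) * (lucas (x + y) q (Suc (Suc (Suc n))) - y * lucas (x + y) q (Suc (Suc n)))
        + q * (lucas (x + y) q (Suc (Suc n)) - y * lucas (x + y) q (Suc n))"
    by (simp only: lucas.simps) algebra
  also have "\<dots> = (x + y) * (path_poly x y q (Suc (Suc (Suc n))) + q * path_poly x y q (Suc n))
      + q * (path_poly x y q (Suc (Suc n)) + q * path_poly x y q n)"
    by (simp only: 3)
  also have "\<dots> = path_poly x y q (Suc (Suc (Suc (Suc n)))) + q * path_poly x y q (Suc (Suc n))"
    by (simp only: path_poly.simps) algebra
  finally show ?case .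
qed (simp_all add: algebra_simps)

text \<open>By \<open>lucas_path_poly\<close>, \<open>cycle_poly\<close> and \<open>lucas\<close>
  satisfy the same inhomogeneous first-order recurrence. Their difference is thus multiplied by
  \<open>y\<close> at each step, starting from \<open>x * y - y + z\<close> at one vertex.\<close>

lemma cycle_poly_lucas:
  "cycle_poly x y z (Suc n) = lucas (x + y) z (Suc n) + y ^ n * (x * y - y + z)"
proof (induction n)
  case (Suc n)
  let ?l = "lucas (x + y) z" and ?k = "x * y - y + z"
  have "cycle_poly x y z (Suc (Suc n))
      = (path_poly x y z (Suc (Suc n)) + z * path_poly x y z n) + y * cycle_poly x y z (Suc n)"
    by simp
  also have "\<dots> = (?l (Suc (Suc n)) - y * ?l (Suc n)) + y * (?l (Suc n) + y ^ n * ?k)"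
    by (simp only: Suc lucas_path_poly)
  also have "\<dots> = ?l (Suc (Suc n)) + y ^ Suc n * ?k"
    by (simp only: power_Suc) algebra
  finally show ?case .
qed (simp add: algebra_simps)

lemma lucas_roots:
  assumes "a + b = p" "a * b = - q"
  shows "lucas p q n = a ^ n + b ^ n"
proof -
  have "q = - (a * b)" using assms by simp
  with assms(1) show ?thesis
  proof (induction p q n rule: lucas.induct)
    case (3 p q n)
    then have "lucas p q (Suc (Suc n)) = (a + b) * (a ^ Suc n + b ^ Suc n) - a * b * (a ^ n + b ^ n)"
      by simp
    then show ?case by (simp add: algebra_simps)
  qed simp_all
qed

text \<open>This is the case of conjugate roots with modulus \<open>\<bar>r\<bar>\<close> and
  arguments given by \<open>t\<close> and \<open>- t\<close> when \<open>r\<close> is positive; the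
  cosine addition formula keeps the induction real.\<close>

lemma lucas_cos:
  assumes "2 * r * cos t = p" "r\<^sup>2 = - q"
  shows "lucas p q n = 2 * r ^ n * cos (real n * t)"
proof -
  have "q = - r\<^sup>2" using assms by simp
  with assms(1) show ?thesis
  proof (induction p q n rule: lucas.induct)
    case (3 p q n)
    have "cos (real (Suc (Suc n)) * t) + cos (real n * t) = 2 * cos t * cos (real (Suc n) * t)"
      using cos_add[of "real (Suc n) * t" t] cos_diff[of "real (Suc n) * t" t]
      by (simp add: algebra_simps)
    then have c: "cos (real (Suc (Suc n)) * t) = 2 * cos t * cos (real (Suc n) * t) - cos (real n * t)"
      by simp
    have "lucas p q (Suc (Suc n)) = 2 * r * cos t * (2 * r ^ Suc n * cos (real (Suc n) * t))
        - r\<^sup>2 * (2 * r ^ n * cos (real n * t))"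
      using 3 by simp
    also have "\<dots> = 2 * r ^ Suc (Suc n) * cos (real (Suc (Suc n)) * t)"
      unfolding c by (simp add: power2_eq_square algebra_simps)
    finally show ?case .
  qed simp_all
qed

text \<open>If nonzero, the root \<open>(p + i * sqrt (- D)) / 2\<close> has modulus
  \<open>sqrt (- q)\<close> and argument \<open>\<phi>\<close>; the claim compares real parts. For
  negative \<open>p\<close> the shift by \<open>pi\<close> moves the angle into the correct
  half-plane.\<close>

lemma cos_angle:
  fixes p q D \<phi> :: real
  assumes D: "D = p\<^sup>2 + 4 * q" "D \<le> 0"
    and \<phi>: "\<phi> = (if p > 0 then arctan (sqrt (- D) / p) else if p = 0 then pi / 2
              else pi + arctan (sqrt (- D) / p))"
  shows "2 * sqrt (- q) * cos \<phi> = p"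
proof (cases "p = 0")
  case False
  \<comment> \<open>This is one plus the squared tangent, to be used in the formula for
    \<open>cos (arctan t)\<close>.\<close>
  have "1 + (sqrt (- D) / p)\<^sup>2 = 4 * (- q) / p\<^sup>2"
    using D False by (simp add: power_divide field_simps)
  then have "cos (arctan (sqrt (- D) / p)) = 1 / sqrt (4 * (- q) / p\<^sup>2)"
    by (simp add: cos_arctan)
  also have "\<dots> = \<bar>p\<bar> / (2 * sqrt (- q))"
    by (simp only: real_sqrt_mult real_sqrt_divide real_sqrt_abs real_sqrt_four) simp
  finally have "cos (arctan (sqrt (- D) / p)) = \<bar>p\<bar> / (2 * sqrt (- q))" .
  moreover have "p\<^sup>2 > 0" using False by simp
  then have "q < 0" using D by linarith
  ultimately show ?thesis using False \<phi> by (auto simp: cos_add)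
next
  case True
  then have "\<phi> = pi / 2" using \<phi> by simp
  then have "cos \<phi> = 0" by (simp only: cos_pi_half)
  then show ?thesis using True by simp
qed

theorem theorem2:
  fixes n :: nat and x y z D \<phi> :: real and C :: "('v, 'e) multigraph"
  assumes "n \<ge> 1"
    and "is_cycle n C"
    and "D = x\<^sup>2 + 2 * x * y + y\<^sup>2 + 4 * z"
    and "\<phi> = (if x + y > 0 then arctan (sqrt (- D) / (x + y))
              else if x + y = 0 then pi / 2
              else pi + arctan (sqrt (- D) / (x + y)))"
  shows "(z \<ge> - ((x + y) / 2)\<^sup>2 \<longrightarrow>
            xi C x y z = ((x + y - sqrt D) / 2) ^ n + ((x + y + sqrt D) / 2) ^ n
                         + y ^ (n - 1) * (x * y - y + z)) \<and>
         (z \<le> - ((x + y) / 2)\<^sup>2 \<longrightarrow>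
            xi C x y z = 2 * (- z) powr (real n / 2) * cos (real n * \<phi>)
                         + y ^ (n - 1) * (x * y - y + z))"
proof -
  obtain vs es e where vs: "length vs = n" "verts C = set vs" "edges C = insert e (set es)"
    "e \<notin> set es" "vs \<noteq> []" "distinct vs" "is_path (ends C) vs es" "ends C e = {hd vs, last vs}"
    using is_cycle_path[OF assms(2)] .
  have "multigraph C" using assms(2) unfolding is_cycle_def by simp
  then have "xi C x y z = cycle_poly x y z n"
    using cycle_value[OF edge_elimination_xi _ vs(2-)] vs(1) by simp
  moreover obtain m where "n = Suc m" using assms(1) by (cases n) auto
  ultimately have xi: "xi C x y z = lucas (x + y) z n + y ^ (n - 1) * (x * y - y + z)"
    using cycle_poly_lucas[of x y z m] by simp
  have D: "D = (x + y)\<^sup>2 + 4 * z"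
    unfolding assms(3) by (simp add: power2_sum)
  \<comment> \<open>The two ranges of \<open>z\<close> are the two signs of the discriminant and
    overlap where it vanishes.\<close>
  have disc: "(z \<ge> - ((x + y) / 2)\<^sup>2 \<longleftrightarrow> D \<ge> 0) \<and> (z \<le> - ((x + y) / 2)\<^sup>2 \<longleftrightarrow> D \<le> 0)"
    unfolding D by (auto simp: power_divide)
  show ?thesis
  proof (intro conjI impI)
    assume "z \<ge> - ((x + y) / 2)\<^sup>2"
    then have "(sqrt D)\<^sup>2 = D" using disc by simp
    moreover have "(x + y - sqrt D) / 2 * ((x + y + sqrt D) / 2) = ((x + y)\<^sup>2 - (sqrt D)\<^sup>2) / 4"
      by (simp add: power2_eq_square algebra_simps)
    ultimately have "(x + y - sqrt D) / 2 * ((x + y + sqrt D) / 2) = - z"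
      using D by simp
    moreover have "(x + y - sqrt D) / 2 + (x + y + sqrt D) / 2 = x + y"
      by (simp add: field_simps)
    ultimately show "xi C x y z = ((x + y - sqrt D) / 2) ^ n + ((x + y + sqrt D) / 2) ^ n
        + y ^ (n - 1) * (x * y - y + z)"
      using xi lucas_roots by metis
  next
    assume "z \<le> - ((x + y) / 2)\<^sup>2"
    then have "D \<le> 0" "z \<le> 0"
      using disc by (auto intro: order_trans)
    have "lucas (x + y) z n = 2 * sqrt (- z) ^ n * cos (real n * \<phi>)"
      by (rule lucas_cos[OF cos_angle[OF D \<open>D \<le> 0\<close> assms(4)]]) (use \<open>z \<le> 0\<close> in simp)
    moreover have "sqrt (- z) ^ n = (- z) powr (real n / 2)"
    \<comment> \<open>At \<open>z = 0\<close> the \<open>powr\<close> side is 0 by convention, and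
      the power on the left is 0 because \<open>n\<close> is positive.\<close>
    proof (cases "z = 0")
      case True
      then show ?thesis using assms(1) by (simp add: power_0_left)
    next
      case False
      then have "sqrt (- z) ^ n = sqrt (- z) powr real n"
        using \<open>z \<le> 0\<close> by (simp add: powr_realpow)
      also have "\<dots> = (- z) powr (1 / 2 * real n)"
        using \<open>z \<le> 0\<close> by (simp add: powr_half_sqrt[symmetric] powr_powr)
      finally show ?thesis by simp
    qed
    ultimately show "xi C x y z = 2 * (- z) powr (real n / 2) * cos (real n * \<phi>)
        + y ^ (n - 1) * (x * y - y + z)"
      using xi by simp
  qed
qed

end
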